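(* Let $T$ be a terrain and $G \subset T$ a finite set of guard candidates with $\mathcal{V}(G) = T$. Let $F$ denote the set of features of the visibility overlay of $G$, for $f \in F$ let $G(f) = \{ g \in G \mid f \subseteq \mathcal{V}(g)\}$, and let $w_f \in f$ be an arbitrary point of the feature $f$. Then for $$W(G) = \{ w_f \mid f \in F,\ G(f) \text{ is inclusion-minimal} \},$$ any feasible solution of $\operatorname{TGP}(G, W(G))$ is feasible for $\operatorname{TGP}(G,T)$.
   Context: A terrain $T$ is an $x$-monotone polygonal chain in the plane with vertices $V = \{v_1,\dots,v_n\}$ (in order of strictly increasing $x$-coordinate) and edges $e_i = \overline{v_i v_{i+1}}$. A point $p \in T$ sees (covers) $q \in T$ iff the segment $\overline{pq}$ is nowhere below $T$. The visibility region of $p \in T$ is $\mathcal{V}(p) = \{ q \in T \mid p \text{ sees } q\}$, and $\mathcal{V}(G) = \bigcup_{g\in G}\mathcal{V}(g)$ for $G \subseteq T$. Terrain Guarding Problem $\operatorname{TGP}(G,W)$: given $G, W \subseteq T$ with $W \subseteq \mathcal{V}(G)$, find a minimum-cardinality set $G^* \subseteq G$ with $W \subseteq \mathcal{V}(G^* )$. A feasible solution of $\operatorname{TGP}(G,W)$ is any $C \subseteq G$ with $W \subseteq \mathcal{V}(C)$. Visibility overlay of a finite set $G \subset T$: each $\mathcal{V}(g)$, $g\in G$, is a finite union of disjoint closed subterrains (its connected components), viewed as closed (possibly degenerate) intervals via projection to the $x$-axis. The end points of all these intervals, over all $g \in G$, subdivide $T$; the features of the overlay are these end points (as single-point sets)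 and the maximal intervals (the open intervals between consecutive end points). All points of a feature are seen by the same guards of $G$. "Inclusion-minimal" means that no feature $f'\in F$ has $G(f') \subsetneq G(f)$. *)

theory Defs
  imports "HOL-Analysis.Analysis"
begin

type_synonym point = "real \<times> real"

text \<open>
  Including the vertices explicitly only matters for a chain with a single vertex, which has no
  edges.
\<close>

definition polygonal_chain :: "point list \<Rightarrow> point set" where
  "polygonal_chain vs =
     set vs \<union> (\<Union>i\<in>{i. Suc i < length vs}. closed_segment (vs ! i) (vs ! Suc i))"

definition is_terrain :: "point set \<Rightarrow> bool" where
  "is_terrain T \<longleftrightarrow>
     (\<exists>vs. vs \<noteq> [] \<and> sorted_wrt (\<lambda>u v. fst u < fst v) vs \<and> T = polygonal_chain vs)"

text \<open>The segment from \<open>p\<close> to \<open>q\<close> may touch \<open>T\<close>, but no point of it lies strictly below \<open>T\<close>.\<close>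

definition sees :: "point set \<Rightarrow> point \<Rightarrow> point \<Rightarrow> bool" where
  "sees T p q \<longleftrightarrow> (\<forall>s\<in>closed_segment p q. \<forall>t\<in>T. fst t = fst s \<longrightarrow> snd t \<le> snd s)"

definition vis :: "point set \<Rightarrow> point \<Rightarrow> point set" where
  "vis T p = {q \<in> T. sees T p q}"

definition Vis :: "point set \<Rightarrow> point set \<Rightarrow> point set" where
  "Vis T G = (\<Union>g\<in>G. vis T g)"

definition tgp_feasible :: "point set \<Rightarrow> point set \<Rightarrow> point set \<Rightarrow> point set \<Rightarrow> bool" where
  "tgp_feasible T G W C \<longleftrightarrow> C \<subseteq> G \<and> W \<subseteq> Vis T C"

text \<open>
  The connected components of a visibility region are closed subterrains, so their projections to
  the x-axis are compact intervals (possibly a single point) with end points \<open>Inf\<close> and \<open>Sup\<close>.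
  End points are recorded by their x-coordinate.
\<close>

definition overlay_endpoints :: "point set \<Rightarrow> point set \<Rightarrow> real set" where
  "overlay_endpoints T G =
     (\<Union>g\<in>G. \<Union>C\<in>components (vis T g). {Inf (fst ` C), Sup (fst ` C)})"

text \<open>
  A feature is a subset of \<open>T\<close>: the point above an end point, or the part of \<open>T\<close> strictly between
  two consecutive end points.
\<close>

definition overlay_features :: "point set \<Rightarrow> point set \<Rightarrow> point set set" where
  "overlay_features T G =
     {{p} | p. p \<in> T \<and> fst p \<in> overlay_endpoints T G} \<union>
     {{p \<in> T. a < fst p \<and> fst p < b} | a b.
        a \<in> overlay_endpoints T G \<and> b \<in> overlay_endpoints T G \<and> a < b \<and>
        overlay_endpoints T G \<inter> {a<..<b} = {}}"

definition feature_guards :: "point set \<Rightarrow> point set \<Rightarrow> point set \<Rightarrow> point set" where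
  "feature_guards T G f = {g \<in> G. f \<subseteq> vis T g}"

definition inclusion_minimal :: "point set \<Rightarrow> point set \<Rightarrow> point set \<Rightarrow> bool" where
  "inclusion_minimal T G f \<longleftrightarrow>
     \<not> (\<exists>f'\<in>overlay_features T G. feature_guards T G f' \<subset> feature_guards T G f)"

definition witnesses :: "point set \<Rightarrow> point set \<Rightarrow> (point set \<Rightarrow> point) \<Rightarrow> point set" where
  "witnesses T G w = {w f | f. f \<in> overlay_features T G \<and> inclusion_minimal T G f}"

end

theory Submission
  imports Defs
begin

text \<open>
  On a single edge a guard sees a convex set, so each visibility region has finitely many
  components and the overlay has finitely many end points; since \<open>G\<close> covers \<open>T\<close>, the extreme
  points of \<open>T\<close> are among them, and every point of \<open>T\<close> lies in a feature. A component meeting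
  an open feature extends over all of it, as none of its end points is inside; so a guard seeing
  the witness of a feature sees the whole feature. Below any feature \<open>f\<close> there is a feature
  \<open>f'\<close> with inclusion-minimal \<open>G(f') \<subseteq> G(f)\<close>, and whoever sees its witness also sees \<open>f\<close>.
\<close>

section \<open>Terrains as graphs made of finitely many segments\<close>

lemma polygonal_chain_Cons2:
  "polygonal_chain (u # v # vs) = closed_segment u v \<union> polygonal_chain (v # vs)"
proof -
  have "{i. Suc i < length (u # v # vs)} = insert 0 (Suc ` {i. Suc i < length (v # vs)})"
    by (auto simp: image_iff gr0_conv_Suc) (metis not0_implies_Suc Suc_less_eq)
  then show ?thesis
    by (auto simp: polygonal_chain_def)
qed

lemma fst_segment_bounds:
  fixes u v p :: point
  assumes "p \<in> closed_segment u v" "fst u < fst v"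
  shows "fst u \<le> fst p" "fst p \<le> fst v" "fst p = fst v \<Longrightarrow> p = v"
proof -
  obtain l where l: "0 \<le> l" "l \<le> 1" "p = (1 - l) *\<^sub>R u + l *\<^sub>R v"
    using assms(1) by (auto simp: in_segment)
  have e: "fst p = fst u + l * (fst v - fst u)"
    by (simp add: l algebra_simps)
  show "fst u \<le> fst p" using e l assms by simp
  have e': "fst p = fst v - (1 - l) * (fst v - fst u)"
    by (simp add: l algebra_simps)
  show "fst p \<le> fst v" using e' l assms by simp
  assume "fst p = fst v"
  then have "l = 1" using e' assms by auto
  then show "p = v" using l by simp
qed

lemma inj_on_fst_segment:
  fixes u v :: point
  assumes "fst u \<noteq> fst v"
  shows "inj_on fst (closed_segment u v)"
proof (rule inj_onI)
  fix p q assume pq: "p \<in> closed_segment u v" "q \<in> closed_segment u v" "fst p = fst q"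
  obtain l where l: "p = (1 - l) *\<^sub>R u + l *\<^sub>R v" using pq by (auto simp: in_segment)
  obtain m where m: "q = (1 - m) *\<^sub>R u + m *\<^sub>R v" using pq by (auto simp: in_segment)
  have "(l - m) * (fst v - fst u) = 0" using pq(3) by (simp add: l m algebra_simps)
  then show "p = q" using assms l m by auto
qed

text \<open>The claims about \<open>hd vs\<close> strengthen the induction: they place the rest of
  the chain weakly to the right of the vertex it shares with the first edge, so the two parts
  overlap in abscissa only at that vertex.\<close>

lemma polygonal_chain_structure:
  assumes "vs \<noteq> []" "sorted_wrt (\<lambda>u v. fst u < fst v) vs"
  shows "inj_on fst (polygonal_chain vs) \<and> hd vs \<in> polygonal_chain vs \<and>
    (\<forall>p\<in>polygonal_chain vs. fst (hd vs) \<le> fst p) \<and>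
    (\<exists>K. finite K \<and> (\<forall>S\<in>K. \<exists>u v. S = closed_segment u v) \<and> polygonal_chain vs = \<Union>K)"
  using assms
proof (induction vs rule: induct_list012)
  case (2 u)
  have "polygonal_chain [u] = {u}" by (simp add: polygonal_chain_def)
  moreover have "\<exists>K. finite K \<and> (\<forall>S\<in>K. \<exists>a b. S = closed_segment a b) \<and> {u} = \<Union>K"
  \<comment> \<open>A lone vertex counts as a degenerate segment, so that \<open>K\<close> always
    consists of segments.\<close>
  proof (intro exI[of _ "{closed_segment u u}"] conjI ballI)
    show "\<exists>a b. S = closed_segment a b" if "S \<in> {closed_segment u u}" for S
      using that by blast
  qed auto
  ultimately show ?case by simp
next
  case (3 u v vs)
  let ?R = "polygonal_chain (v # vs)" and ?S = "closed_segment u v"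
  have uv: "fst u < fst v" using 3 by simp
  have IH: "inj_on fst ?R" "v \<in> ?R" "\<forall>p\<in>?R. fst v \<le> fst p"
    "\<exists>K. finite K \<and> (\<forall>S\<in>K. \<exists>u v. S = closed_segment u v) \<and> ?R = \<Union>K"
    using 3 by auto
  have meet: "p = q" if "p \<in> ?S" "q \<in> ?R" "fst p = fst q" for p q
  proof -
    have "fst p = fst v" using that fst_segment_bounds(2)[OF that(1) uv] IH(3) by force
    then show ?thesis
      using that IH(1,2) fst_segment_bounds(3)[OF that(1) uv] by (metis inj_onD)
  qed
  have "inj_on fst (?S \<union> ?R)"
    using inj_on_fst_segment[of u v] uv IH(1) meet
    unfolding inj_on_def by (metis Un_iff less_irrefl)
  moreover have "\<forall>p\<in>?S \<union> ?R. fst u \<le> fst p"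
    using fst_segment_bounds(1)[OF _ uv] IH(3) uv by force
  moreover have "\<exists>K. finite K \<and> (\<forall>S\<in>K. \<exists>u v. S = closed_segment u v) \<and> ?S \<union> ?R = \<Union>K"
  proof -
    obtain K where K: "finite K" "\<forall>S\<in>K. \<exists>u v. S = closed_segment u v" "?R = \<Union>K"
      using IH(4) by blast
    show ?thesis
    proof (intro exI[of _ "insert ?S K"] conjI)
      show "\<forall>S\<in>insert ?S K. \<exists>a b. S = closed_segment a b" using K(2) by blast
    qed (use K(1,3) in auto)
  qed
  ultimately show ?case by (simp add: polygonal_chain_Cons2)
qed auto

lemma terrain_structure:
  assumes "is_terrain T"
  obtains K where "inj_on fst T" "finite K" "T = \<Union>K"
    "\<And>S. S \<in> K \<Longrightarrow> \<exists>u v. S = closed_segment u v"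
  using assms polygonal_chain_structure unfolding is_terrain_def by metis

section \<open>Visibility along a single edge\<close>

text \<open>The slope from \<open>g\<close> to \<open>t\<close> must not exceed the slope from
  \<open>g\<close> to \<open>q\<close>, cleared of denominators. In this form the condition also
  covers \<open>fst t = fst g\<close> and is linear in \<open>q\<close> for fixed \<open>g\<close>
  and \<open>t\<close>.\<close>

lemma sees_right_iff:
  assumes "fst g < fst q"
  shows "sees T g q \<longleftrightarrow> (\<forall>t\<in>T. fst g \<le> fst t \<and> fst t \<le> fst q \<longrightarrow>
    (snd t - snd g) * (fst q - fst g) \<le> (snd q - snd g) * (fst t - fst g))"
proof (intro iffI ballI impI)
  fix t assume s: "sees T g q" and t: "t \<in> T" "fst g \<le> fst t \<and> fst t \<le> fst q"
  define l where "l = (fst t - fst g) / (fst q - fst g)"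
  have l: "l * (fst q - fst g) = fst t - fst g" using assms by (simp add: l_def)
  have l01: "0 \<le> l" "l \<le> 1" using t assms by (simp_all add: l_def)
  have "g + l *\<^sub>R (q - g) \<in> closed_segment g q"
    using l01 by (auto simp: in_segment algebra_simps intro!: exI[of _ l])
  moreover have "fst (g + l *\<^sub>R (q - g)) = fst t" using l by simp
  ultimately have "snd t \<le> snd (g + l *\<^sub>R (q - g))"
    using s t unfolding sees_def by metis
  then have "snd t - snd g \<le> l * (snd q - snd g)" by simp
  then have "(snd t - snd g) * (fst q - fst g) \<le> l * (snd q - snd g) * (fst q - fst g)"
    using assms by (intro mult_right_mono) auto
  also have "\<dots> = (snd q - snd g) * (l * (fst q - fst g))" by simp
  finally show "(snd t - snd g) * (fst q - fst g) \<le> (snd q - snd g) * (fst t - fst g)"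
    by (simp only: l)
next
  assume H: "\<forall>t\<in>T. fst g \<le> fst t \<and> fst t \<le> fst q \<longrightarrow>
    (snd t - snd g) * (fst q - fst g) \<le> (snd q - snd g) * (fst t - fst g)"
  show "sees T g q"
    unfolding sees_def
  proof (intro ballI impI)
    fix s t assume s: "s \<in> closed_segment g q" and t: "t \<in> T" "fst t = fst s"
    obtain l where l: "0 \<le> l" "l \<le> 1" "s = (1 - l) *\<^sub>R g + l *\<^sub>R q"
      using s by (auto simp: in_segment)
    have ft: "fst t - fst g = l * (fst q - fst g)"
      and fs: "snd s - snd g = l * (snd q - snd g)"
      by (simp_all add: t(2) l(3) algebra_simps)
    have "(snd t - snd g) * (fst q - fst g) \<le> (snd q - snd g) * (fst t - fst g)"
      using H t fst_segment_bounds(1,2)[OF s assms] by metis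
    also have "\<dots> = (snd s - snd g) * (fst q - fst g)" by (simp add: ft fs)
    finally show "snd t \<le> snd s" using assms by simp
  qed
qed

text \<open>Since \<open>T\<close> is a graph over the x-axis, the only terrain point over a point
  of the segment is that point itself.\<close>

lemma sees_along_segment:
  assumes "inj_on fst T" "closed_segment p q \<subseteq> T"
  shows "sees T p q"
  using assms unfolding sees_def by (metis inj_onD order_refl subsetD)

text \<open>
  A point beyond \<open>a\<close> and in front of \<open>q\<close> lies on the edge itself; it cannot block, because
  \<open>b\<close> being visible past \<open>a\<close> puts \<open>g\<close> above the line through the edge.
\<close>

lemma sees_between_right:
  assumes inj: "inj_on fst T" and T: "closed_segment a b \<subseteq> T"
    and see: "sees T g a" "sees T g b"
    and q: "q \<in> closed_segment a b" and ga: "fst g < fst a" and ab: "fst a < fst b"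
  shows "sees T g q"
proof -
  obtain l where l: "0 \<le> l" "l \<le> 1" "q = (1 - l) *\<^sub>R a + l *\<^sub>R b"
    using q by (auto simp: in_segment)
  have aq: "fst a \<le> fst q" "fst q \<le> fst b" using fst_segment_bounds[OF q ab] by auto
  have gq: "fst g < fst q" and gb: "fst g < fst b" using ga ab aq by auto
  define A B C D where "A = fst a - fst g" "B = snd a - snd g"
    "C = fst b - fst g" "D = snd b - snd g"
  note defs = this
  have AC: "0 < A" "A < C" using ga ab by (simp_all add: defs)
  have q1: "fst q - fst g = (1 - l) * A + l * C" "snd q - snd g = (1 - l) * B + l * D"
    by (simp_all add: l defs algebra_simps)
  have "a \<in> T" using T by auto
  then have BD: "B * C \<le> D * A"
    using see(2) ga ab unfolding sees_right_iff[OF gb] by (auto simp: defs)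
  show ?thesis
    unfolding sees_right_iff[OF gq]
  proof (intro ballI impI)
    fix t assume t: "t \<in> T" "fst g \<le> fst t \<and> fst t \<le> fst q"
    show "(snd t - snd g) * (fst q - fst g) \<le> (snd q - snd g) * (fst t - fst g)"
    proof (cases "fst t \<le> fst a")
      case True
      have 1: "(snd t - snd g) * A \<le> B * (fst t - fst g)"
        using see(1) t True unfolding sees_right_iff[OF ga] defs by auto
      have 2: "(snd t - snd g) * C \<le> D * (fst t - fst g)"
        using see(2) t True ab unfolding sees_right_iff[OF gb] defs by auto
      \<comment> \<open>For \<open>t\<close> not beyond \<open>a\<close>, the conditions for
        \<open>a\<close> and \<open>b\<close> both apply; by linearity their convex combination with
        the weights of \<open>q\<close> is the condition for \<open>q\<close>.\<close>
      have "(1 - l) * ((snd t - snd g) * A) + l * ((snd t - snd g) * C)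
          \<le> (1 - l) * (B * (fst t - fst g)) + l * (D * (fst t - fst g))"
        using 1 2 l by (intro add_mono mult_left_mono) auto
      then show ?thesis unfolding q1 by (simp add: algebra_simps)
    next
      case False
      define m where "m = (fst t - fst a) / (fst b - fst a)"
      have m: "m * (fst b - fst a) = fst t - fst a" using ab by (simp add: m_def)
      have m01: "0 \<le> m" "m \<le> 1" using False t aq ab by (simp_all add: m_def)
      have s: "(1 - m) *\<^sub>R a + m *\<^sub>R b \<in> closed_segment a b"
        using m01 by (auto simp: in_segment)
      have "fst ((1 - m) *\<^sub>R a + m *\<^sub>R b) = fst t" using m by (simp add: algebra_simps)
      then have teq: "t = (1 - m) *\<^sub>R a + m *\<^sub>R b"
        using inj t T s by (metis inj_onD subsetD)
      have t1: "fst t - fst g = (1 - m) * A + m * C" "snd t - snd g = (1 - m) * B + m * D"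
        by (simp_all add: teq defs algebra_simps)
      have "m * (fst b - fst a) \<le> l * (fst b - fst a)"
        using t by (simp add: m) (simp add: l algebra_simps)
      then have "m \<le> l" using ab by simp
      \<comment> \<open>With \<open>t\<close> at parameter \<open>m\<close> and \<open>q\<close> at
        parameter \<open>l\<close> of the edge, this product is exactly the right side minus the
        left side of the goal.\<close>
      then have "0 \<le> (l - m) * (D * A - B * C)" using BD by simp
      then show ?thesis unfolding q1 t1 by (simp add: algebra_simps)
    qed
  qed
qed

text \<open>Reflection in the vertical axis keeps heights and hence visibility, so a guard to the
  right of an edge reduces to one on its left.\<close>

definition mirror :: "point \<Rightarrow> point" where
  "mirror p = (- fst p, snd p)"

lemma linear_mirror: "linear mirror"
  by (rule linearI) (auto simp: mirror_def)

lemma mirror_mirror [simp]: "mirror (mirror p) = p"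
  by (simp add: mirror_def)

lemma closed_segment_mirror: "closed_segment (mirror p) (mirror q) = mirror ` closed_segment p q"
  by (rule closed_segment_linear_image[OF linear_mirror])

lemma sees_mirror: "sees (mirror ` T) (mirror p) (mirror q) \<longleftrightarrow> sees T p q"
  by (simp add: sees_def closed_segment_mirror) (simp add: mirror_def)

lemma inj_on_fst_mirror:
  assumes "inj_on fst T"
  shows "inj_on fst (mirror ` T)"
  using assms by (auto simp: inj_on_def mirror_def)

text \<open>A guard left of the segment is the case already treated, and one to its right is its
  mirror image. A guard over the x-range of the segment lies on it, and then sees along it.\<close>

lemma sees_between:
  assumes inj: "inj_on fst T" and g: "g \<in> T" and T: "closed_segment a b \<subseteq> T"
    and see: "sees T g a" "sees T g b" and q: "q \<in> closed_segment a b"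
    and ab: "fst a < fst b"
  shows "sees T g q"
proof -
  consider "fst g < fst a" | "fst b < fst g" | "fst a \<le> fst g" "fst g \<le> fst b" by linarith
  then show ?thesis
  proof cases
    case 1
    then show ?thesis using sees_between_right[OF inj T see q] ab by simp
  next
    case 2
    have "sees (mirror ` T) (mirror g) (mirror q)"
    proof (rule sees_between_right)
      show "inj_on fst (mirror ` T)" by (rule inj_on_fst_mirror[OF inj])
      \<comment> \<open>Reflection reverses the order of the abscissas, hence the end points swap
        roles.\<close>
      show "closed_segment (mirror b) (mirror a) \<subseteq> mirror ` T"
        using T by (auto simp: closed_segment_mirror closed_segment_commute)
      show "mirror q \<in> closed_segment (mirror b) (mirror a)"
        using q by (auto simp: closed_segment_mirror closed_segment_commute)
    qed (use see ab 2 in \<open>auto simp: sees_mirror\<close>, simp_all add: mirror_def)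
    then show ?thesis by (simp add: sees_mirror)
  next
    case 3
    define m where "m = (fst g - fst a) / (fst b - fst a)"
    have m: "m * (fst b - fst a) = fst g - fst a" using ab by (simp add: m_def)
    have m01: "0 \<le> m" "m \<le> 1" using 3 ab by (simp_all add: m_def)
    have s: "(1 - m) *\<^sub>R a + m *\<^sub>R b \<in> closed_segment a b"
      using m01 by (auto simp: in_segment)
    have "fst ((1 - m) *\<^sub>R a + m *\<^sub>R b) = fst g" using m by (simp add: algebra_simps)
    then have "g \<in> closed_segment a b"
      using inj g T s by (metis inj_onD subsetD)
    then show ?thesis
      using q T by (intro sees_along_segment[OF inj]) (meson subset_closed_segment order_trans)
  qed
qed

lemma convex_vis_inter_segment:
  assumes inj: "inj_on fst T" and g: "g \<in> T" and T: "closed_segment u v \<subseteq> T"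
  shows "convex (vis T g \<inter> closed_segment u v)"
  unfolding convex_contains_segment
proof (intro ballI subsetI)
  fix a b q
  assume a: "a \<in> vis T g \<inter> closed_segment u v" and b: "b \<in> vis T g \<inter> closed_segment u v"
    and q: "q \<in> closed_segment a b"
  have ab: "closed_segment a b \<subseteq> closed_segment u v" using a b by (simp add: subset_closed_segment)
  have "sees T g q"
  proof (cases "fst a" "fst b" rule: linorder_cases)
    case less
    then show ?thesis using sees_between[OF inj g _ _ _ q] a b ab T by (auto simp: vis_def)
  next
    case equal
    then have "a = b" using a b inj by (auto simp: vis_def dest: inj_onD)
    then show ?thesis using q a by (simp add: vis_def)
  next
    case greater
    then show ?thesis using sees_between[OF inj g, of b a q] q a b ab T
      by (auto simp: vis_def closed_segment_commute)
  qed
  then show "q \<in> vis T g \<inter> closed_segment u v"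
    using q ab T by (auto simp: vis_def)
qed

section \<open>Finiteness of the overlay\<close>

text \<open>A connected member lies in a single component, so each component is that of the chosen
  point of some nonempty member. An empty member yields an arbitrary value, which is harmless
  because the image only has to contain all components.\<close>

lemma finite_components_Union:
  assumes "finite A" "\<And>S. S \<in> A \<Longrightarrow> connected S"
  shows "finite (components (\<Union>A))"
proof (rule finite_surj[OF assms(1)])
  show "components (\<Union>A) \<subseteq> (\<lambda>S. connected_component_set (\<Union>A) (SOME x. x \<in> S)) ` A"
  proof
    fix C assume "C \<in> components (\<Union>A)"
    then obtain x where x: "x \<in> \<Union>A" "C = connected_component_set (\<Union>A) x"
      by (auto simp: components_def)
    then obtain S where S: "S \<in> A" "x \<in> S" by auto
    then have "(SOME y. y \<in> S) \<in> S" by (metis someI)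
    then have "connected_component (\<Union>A) x (SOME y. y \<in> S)"
      using S assms(2) unfolding connected_component_def by (intro exI[of _ S]) auto
    then have "C = connected_component_set (\<Union>A) (SOME y. y \<in> S)"
      using x by (simp add: connected_component_eq)
    then show "C \<in> (\<lambda>S. connected_component_set (\<Union>A) (SOME x. x \<in> S)) ` A" using S by blast
  qed
qed

lemma finite_components_vis:
  assumes "is_terrain T" "g \<in> T"
  shows "finite (components (vis T g))"
proof -
  obtain K where K: "inj_on fst T" "finite K" "T = \<Union>K"
    "\<And>S. S \<in> K \<Longrightarrow> \<exists>u v. S = closed_segment u v"
    using terrain_structure[OF assms(1)] by metis
  \<comment> \<open>The edges cut the visibility region into finitely many convex pieces.\<close>
  have "vis T g = \<Union>((\<lambda>S. vis T g \<inter> S) ` K)" using K(3) by (auto simp: vis_def)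
  moreover have "finite (components (\<Union>((\<lambda>S. vis T g \<inter> S) ` K)))"
  proof (rule finite_components_Union)
    fix S' assume "S' \<in> (\<lambda>S. vis T g \<inter> S) ` K"
    then obtain S where S: "S \<in> K" "S' = vis T g \<inter> S" by auto
    then obtain u v where "S = closed_segment u v" using K(4) by blast
    then show "connected S'"
      using convex_vis_inter_segment[OF K(1) assms(2), of u v] S K(3) convex_connected by auto
  qed (use K in auto)
  ultimately show ?thesis by simp
qed

lemma finite_overlay_endpoints:
  assumes "is_terrain T" "finite G" "G \<subseteq> T"
  shows "finite (overlay_endpoints T G)"
  unfolding overlay_endpoints_def using assms finite_components_vis by auto

section \<open>Every point of the terrain lies in a feature\<close>

lemma compact_terrain:
  assumes "is_terrain T"
  shows "compact T"
proof -
  obtain K where K: "finite K" "T = \<Union>K" "\<And>S. S \<in> K \<Longrightarrow> \<exists>u v. S = closed_segment u v"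
    using terrain_structure[OF assms] by metis
  then show ?thesis
    using compact_Union[of K] compact_segment by metis
qed

lemma component_of_seen_point:
  assumes "q \<in> vis T g" "g \<in> G"
  obtains C where "q \<in> C" "C \<subseteq> vis T g" "connected C"
    "Inf (fst ` C) \<in> overlay_endpoints T G" "Sup (fst ` C) \<in> overlay_endpoints T G"
proof -
  obtain C where "C \<in> components (vis T g)" "q \<in> C"
    using assms(1) Union_components by blast
  then show ?thesis
    using that assms(2) in_components_subset in_components_connected
    unfolding overlay_endpoints_def by blast
qed

text \<open>By compactness \<open>T\<close> has a leftmost and a rightmost point. Some guard sees
  each of them, and such a point is also extreme in its component, so its abscissa is an end
  point.\<close>

lemma overlay_endpoints_enclose:
  assumes terrain: "is_terrain T" and cover: "Vis T G = T" and p: "p \<in> T"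
  shows "\<exists>a\<in>overlay_endpoints T G. a \<le> fst p" "\<exists>b\<in>overlay_endpoints T G. fst p \<le> b"
proof -
  have comp: "compact T" and ne: "T \<noteq> {}" using compact_terrain terrain p by auto
  have cont: "continuous_on T fst" by (intro continuous_intros)
  obtain l where l: "l \<in> T" "\<And>t. t \<in> T \<Longrightarrow> fst l \<le> fst t"
    using continuous_attains_inf[OF comp ne cont] by blast
  obtain r where r: "r \<in> T" "\<And>t. t \<in> T \<Longrightarrow> fst t \<le> fst r"
    using continuous_attains_sup[OF comp ne cont] by blast
  obtain g where g: "g \<in> G" "l \<in> vis T g" using l cover unfolding Vis_def by blast
  obtain C where C: "l \<in> C" "C \<subseteq> vis T g" "Inf (fst ` C) \<in> overlay_endpoints T G"
    using component_of_seen_point[OF g(2,1)] by metis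
  have "Inf (fst ` C) = fst l"
    using C l by (intro cInf_eq_minimum) (auto simp: vis_def)
  then show "\<exists>a\<in>overlay_endpoints T G. a \<le> fst p" using C l p by metis
  obtain h where h: "h \<in> G" "r \<in> vis T h" using r cover unfolding Vis_def by blast
  obtain D where D: "r \<in> D" "D \<subseteq> vis T h" "Sup (fst ` D) \<in> overlay_endpoints T G"
    using component_of_seen_point[OF h(2,1)] by metis
  have "Sup (fst ` D) = fst r"
    using D r by (intro cSup_eq_maximum) (auto simp: vis_def)
  then show "\<exists>b\<in>overlay_endpoints T G. fst p \<le> b" using D r p by metis
qed

lemma overlay_features_cover:
  assumes "is_terrain T" "finite G" "G \<subseteq> T" "Vis T G = T" "p \<in> T"
  obtains f where "f \<in> overlay_features T G" "p \<in> f"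
proof (cases "fst p \<in> overlay_endpoints T G")
  case True
  then have "{p} \<in> overlay_features T G" using assms(5) unfolding overlay_features_def by blast
  then show ?thesis using that by blast
next
  case False
  let ?E = "overlay_endpoints T G"
  have fin: "finite ?E" using finite_overlay_endpoints assms by blast
  \<comment> \<open>The nearest end points on either side of \<open>p\<close>; an end point strictly
    between them would be a nearer one.\<close>
  define a b where "a = Max {x\<in>?E. x \<le> fst p}" "b = Min {x\<in>?E. fst p \<le> x}"
  note ab = this
  have ne: "{x\<in>?E. x \<le> fst p} \<noteq> {}" "{x\<in>?E. fst p \<le> x} \<noteq> {}"
    using overlay_endpoints_enclose[OF assms(1,4,5)] by auto
  have a: "a \<in> ?E" "a \<le> fst p" using Max_in[OF _ ne(1)] fin ab by auto
  have b: "b \<in> ?E" "fst p \<le> b" using Min_in[OF _ ne(2)] fin ab by auto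
  have "x \<le> a" if "x \<in> ?E" "x \<le> fst p" for x using that fin ab by (auto intro: Max_ge)
  moreover have "b \<le> x" if "x \<in> ?E" "fst p \<le> x" for x using that fin ab by (auto intro: Min_le)
  ultimately have gap: "?E \<inter> {a<..<b} = {}" by (force simp: not_le)
  have lt: "a < fst p" "fst p < b" using a b False by (metis order_le_less)+
  have "{p \<in> T. a < fst p \<and> fst p < b} \<in> overlay_features T G"
    unfolding overlay_features_def using a b gap lt by force
  then show ?thesis using that lt assms(5) by blast
qed

section \<open>From one seen point to the whole feature\<close>

lemma feature_seen_uniformly:
  assumes terrain: "is_terrain T" and f: "f \<in> overlay_features T G" and g: "g \<in> G"
    and q: "q \<in> f" "q \<in> vis T g"
  shows "f \<subseteq> vis T g"
proof -
  consider "f = {q}" | a b where "f = {p \<in> T. a < fst p \<and> fst p < b}"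
      "overlay_endpoints T G \<inter> {a<..<b} = {}"
    using f q(1) unfolding overlay_features_def by blast
  then show ?thesis
  proof cases
    case 1
    then show ?thesis using q by simp
  next
    case 2
    obtain C where C: "q \<in> C" "C \<subseteq> vis T g" "connected C"
      "Inf (fst ` C) \<in> overlay_endpoints T G" "Sup (fst ` C) \<in> overlay_endpoints T G"
      using component_of_seen_point[OF q(2) g] .
    have inj: "inj_on fst T" using terrain_structure[OF terrain] by metis
    have CT: "C \<subseteq> T" using C(2) by (auto simp: vis_def)
    \<comment> \<open>Boundedness makes \<open>Inf\<close> and \<open>Sup\<close> of the projection
      genuine bounds.\<close>
    have "bounded (fst ` T)"
      using compact_terrain[OF terrain] by (intro bounded_fst compact_imp_bounded)
    then have bnd: "bdd_below (fst ` C)" "bdd_above (fst ` C)"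
      using CT by (meson bounded_subset image_mono bounded_imp_bdd_below bounded_imp_bdd_above)+
    have ne: "fst ` C \<noteq> {}" using C(1) by auto
    have "connected (fst ` C)"
      using C(3) by (intro connected_continuous_image continuous_intros)
    \<comment> \<open>The projection of \<open>C\<close> is an interval, so it contains all that
      lies strictly between its bounds, whether or not these are attained.\<close>
    then have iv: "x \<in> fst ` C" if x: "Inf (fst ` C) < x" "x < Sup (fst ` C)" for x
    proof -
      obtain y where "y \<in> fst ` C" "y < x" using x(1) cInf_less_iff[OF ne bnd(1)] by blast
      moreover obtain z where "z \<in> fst ` C" "x < z" using x(2) less_cSup_iff[OF ne bnd(2)] by blast
      ultimately show ?thesis
        using \<open>connected (fst ` C)\<close> unfolding connected_iff_interval by (meson less_imp_le)
    qed
    have "Inf (fst ` C) \<le> fst q" "fst q \<le> Sup (fst ` C)"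
      using C(1) bnd by (auto intro: cInf_lower cSup_upper)
    moreover have "a < fst q" "fst q < b" using q(1) 2 by auto
    \<comment> \<open>Both bounds are end points and so avoid the gap between \<open>a\<close> and
      \<open>b\<close>, which contains \<open>fst q\<close>; hence the projection of
      \<open>C\<close> spans the gap.\<close>
    ultimately have le: "Inf (fst ` C) \<le> a" "b \<le> Sup (fst ` C)"
      using C(4,5) 2(2) by (force simp: not_le)+
    show ?thesis
    proof
      fix p assume "p \<in> f"
      then have p: "p \<in> T" "a < fst p" "fst p < b" using 2 by auto
      then have "fst p \<in> fst ` C" using le iv by auto
      then obtain p' where "p' \<in> C" "fst p = fst p'" by blast
      then have "p \<in> C" using inj_onD[OF inj, of p p'] p(1) CT by auto
      then show "p \<in> vis T g" using C by auto
    qed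
  qed
qed

section \<open>From the witnesses to the whole terrain\<close>

theorem theorem2:
  fixes T G C :: "point set" and w :: "point set \<Rightarrow> point"
  assumes "is_terrain T"
    and "finite G" and "G \<subseteq> T" and "Vis T G = T"
    and "\<And>f. f \<in> overlay_features T G \<Longrightarrow> w f \<in> f"
    and "tgp_feasible T G (witnesses T G w) C"
  shows "tgp_feasible T G T C"
proof -
  have CG: "C \<subseteq> G" and wC: "witnesses T G w \<subseteq> Vis T C"
    using assms(6) by (auto simp: tgp_feasible_def)
  have "p \<in> Vis T C" if p: "p \<in> T" for p
  proof -
    obtain f where f: "f \<in> overlay_features T G" "p \<in> f"
      using overlay_features_cover[OF assms(1-4) p] .
    let ?below = "{f' \<in> overlay_features T G. feature_guards T G f' \<subseteq> feature_guards T G f}"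
    \<comment> \<open>Minimizing the number of guards among the features below \<open>f\<close>
      gives a feature with inclusion-minimal guard set: a strictly smaller guard set would also be
      below \<open>f\<close> and have fewer elements.\<close>
    obtain f' where f': "f' \<in> ?below"
      and least: "\<And>h. h \<in> ?below \<Longrightarrow>
        card (feature_guards T G f') \<le> card (feature_guards T G h)"
      using f(1) ex_has_least_nat[of "\<lambda>h. h \<in> ?below" f "\<lambda>h. card (feature_guards T G h)"]
      by auto
    have "inclusion_minimal T G f'"
      unfolding inclusion_minimal_def
    proof
      assume "\<exists>h\<in>overlay_features T G. feature_guards T G h \<subset> feature_guards T G f'"
      then obtain h where h: "h \<in> overlay_features T G"
        "feature_guards T G h \<subset> feature_guards T G f'" by blast
      moreover have "finite (feature_guards T G f')"
        using assms(2) by (simp add: feature_guards_def)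
      ultimately have "card (feature_guards T G h) < card (feature_guards T G f')"
        by (intro psubset_card_mono)
      moreover have "h \<in> ?below" using h f' by blast
      ultimately show False using least by (meson leD)
    qed
    then have "w f' \<in> witnesses T G w" using f' by (auto simp: witnesses_def)
    then obtain c where c: "c \<in> C" "w f' \<in> vis T c" using wC by (auto simp: Vis_def)
    then have "f' \<subseteq> vis T c"
      using feature_seen_uniformly[OF assms(1) _ _ assms(5) c(2)] f' CG by auto
    \<comment> \<open>Seeing all of \<open>f'\<close> puts \<open>c\<close> into the guard set of
      \<open>f'\<close>, which is contained in that of \<open>f\<close>.\<close>
    then have "c \<in> feature_guards T G f" using f' c CG by (auto simp: feature_guards_def)
    then show ?thesis using f c by (auto simp: feature_guards_def Vis_def)
  qed
  then show ?thesis using CG by (auto simp: tgp_feasible_def)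
qed

end
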